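(* Let $\Omega\subset\mathbb{R}^n$ be open and let $u,v:\Omega\to\mathbb{R}$ be two convex functions such that $$e^{-u}\,\mathrm{M}[u]\geq e^{-v}\,\mathrm{M}[v]$$ in the sense of measures on $\Omega$, and such that $u-v$ achieves a local strict maximum at a point $x_0\in\Omega$. Then $u(x_0)\leq v(x_0)$.
   Context: For a convex function $u$ on an open set $\Omega\subset\mathbb{R}^n$, the subdifferential is $\partial u(x_0)=\{p\in\mathbb{R}^n: u(x)\geq u(x_0)+p\cdot(x-x_0)\ \ \forall x\in\Omega\}$, and $\partial u(E)=\bigcup_{x\in E}\partial u(x)$ for $E\subset\Omega$. The (Alexandrov) Monge-Ampère measure of $u$ is the Borel measure $\mathrm{M}[u](E)=|\partial u(E)|$ (Lebesgue measure) for Borel sets $E\subset\Omega$. $e^{-u}\mathrm{M}[u]$ is the measure with density $e^{-u}$ with respect to $\mathrm{M}[u]$. *)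

theory Defs
  imports "HOL-Analysis.Analysis"
begin

definition subdifferential ::
    "(real ^ 'n) set \<Rightarrow> (real ^ 'n \<Rightarrow> real) \<Rightarrow> real ^ 'n \<Rightarrow> (real ^ 'n) set" where
  "subdifferential \<Omega> u x0 = {p. \<forall>x\<in>\<Omega>. u x \<ge> u x0 + p \<bullet> (x - x0)}"

definition subdifferential_image ::
    "(real ^ 'n) set \<Rightarrow> (real ^ 'n \<Rightarrow> real) \<Rightarrow> (real ^ 'n) set \<Rightarrow> (real ^ 'n) set" where
  "subdifferential_image \<Omega> u E = (\<Union>x\<in>E. subdifferential \<Omega> u x)"

(* measure_of yields the null measure when the given set function is not countably additive.
   This does not happen when \<Omega> is open and u is convex on \<Omega>: by Alexandrov's theorem the image
   of a Borel set is then Lebesgue measurable (though possibly not Borel, hence lebesgue rather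
   than lborel), and the set function is countably additive on the Borel subsets of \<Omega>. *)
definition monge_ampere ::
    "(real ^ 'n) set \<Rightarrow> (real ^ 'n \<Rightarrow> real) \<Rightarrow> (real ^ 'n) measure" where
  "monge_ampere \<Omega> u =
     measure_of \<Omega> {E. E \<in> sets borel \<and> E \<subseteq> \<Omega>}
       (\<lambda>E. emeasure lebesgue (subdifferential_image \<Omega> u E))"

definition exp_monge_ampere ::
    "(real ^ 'n) set \<Rightarrow> (real ^ 'n \<Rightarrow> real) \<Rightarrow> (real ^ 'n) measure" where
  "exp_monge_ampere \<Omega> u = density (monge_ampere \<Omega> u) (\<lambda>x. ennreal (exp (- u x)))"

definition strict_local_max_at ::
    "'a::metric_space set \<Rightarrow> ('a \<Rightarrow> real) \<Rightarrow> 'a \<Rightarrow> bool" where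
  "strict_local_max_at \<Omega> f x0 \<longleftrightarrow>
     x0 \<in> \<Omega> \<and> (\<exists>r>0. \<forall>x\<in>\<Omega> \<inter> ball x0 r. x \<noteq> x0 \<longrightarrow> f x < f x0)"

end

theory Submission
  imports Defs
begin

text \<open>Suppose \<open>m = u x0 - v x0 > 0\<close>, and let \<open>A\<close> be the part of a small ball around \<open>x0\<close> where
  \<open>u - v > c\<close>, with \<open>c < m\<close> an upper bound of \<open>u - v\<close> on the sphere. Sliding supporting planes of
  \<open>u\<close> down to \<open>v\<close> gives \<open>\<partial>u(A) \<subseteq> \<partial>v(A)\<close>, so \<open>M[u](A) \<le> M[v](A)\<close>. On the other hand \<open>u\<close> and \<open>v\<close> are
  nearly constant on \<open>A\<close>, so the hypothesis yields \<open>M[u](A) \<ge> exp(m/3) M[v](A)\<close>. This is impossible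
  because \<open>0 < M[v](A) < \<infinity>\<close>: planes whose slope is close to that of a supporting plane of \<open>u\<close> at
  \<open>x0\<close> also slide down to touch \<open>v\<close> inside \<open>A\<close>.\<close>

section \<open>Compactness of slope sets over compact sets\<close>

lemma mem_subdifferential_image:
  "p \<in> subdifferential_image \<Omega> u E \<longleftrightarrow>
     (\<exists>x\<in>E. \<forall>y\<in>\<Omega>. u x + p \<bullet> (y - x) \<le> u y)"
  by (simp add: subdifferential_image_def subdifferential_def)

lemma subdifferential_image_UN:
  "subdifferential_image \<Omega> u (\<Union>i\<in>I. E i) = (\<Union>i\<in>I. subdifferential_image \<Omega> u (E i))"
  by (auto simp: subdifferential_image_def)

text \<open>Closedness: contact points subconverge in \<open>K\<close>, and the supporting
  inequality passes to the limit. Boundedness: moving from \<open>x\<close> a distance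
  \<open>e\<close> in the direction of a slope \<open>p\<close> raises \<open>u\<close> by at least
  \<open>e * norm p\<close>, which cannot exceed the oscillation of \<open>u\<close> near
  \<open>K\<close>.\<close>

lemma compact_subdifferential_image:
  fixes u :: "real ^ 'n \<Rightarrow> real"
  assumes \<Omega>: "open \<Omega>" and u: "continuous_on \<Omega> u" and K: "compact K" "K \<subseteq> \<Omega>"
  shows "compact (subdifferential_image \<Omega> u K)"
proof -
  have "closed (subdifferential_image \<Omega> u K)"
    unfolding closed_sequential_limits
  proof (intro allI impI, elim conjE)
    fix p l assume "\<forall>n. p n \<in> subdifferential_image \<Omega> u K" and p: "p \<longlonglongrightarrow> l"
    then obtain x where xK: "\<And>n. x n \<in> K"
      and x: "\<And>n y. y \<in> \<Omega> \<Longrightarrow> u (x n) + p n \<bullet> (y - x n) \<le> u y"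
      unfolding mem_subdifferential_image by metis
    obtain z r where z: "z \<in> K" and r: "strict_mono r" and xr: "(x \<circ> r) \<longlonglongrightarrow> z"
      using K(1) xK unfolding compact_def by metis
    have "(\<lambda>n. u ((x \<circ> r) n)) \<longlonglongrightarrow> u z"
      by (rule continuous_on_tendsto_compose[OF u xr])
        (use z K(2) xK in \<open>auto intro!: always_eventually\<close>)
    moreover have "(p \<circ> r) \<longlonglongrightarrow> l"
      using p r by (rule LIMSEQ_subseq_LIMSEQ)
    ultimately have "(\<lambda>n. u ((x \<circ> r) n) + (p \<circ> r) n \<bullet> (y - (x \<circ> r) n)) \<longlonglongrightarrow> u z + l \<bullet> (y - z)" for y
      using xr by (intro tendsto_intros)
    then have "u z + l \<bullet> (y - z) \<le> u y" if "y \<in> \<Omega>" for y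
      by (rule LIMSEQ_le_const2) (use x that in auto)
    with z show "l \<in> subdifferential_image \<Omega> u K"
      by (auto simp: mem_subdifferential_image)
  qed
  moreover have "bounded (subdifferential_image \<Omega> u K)"
  proof -
    obtain e where e: "e > 0" "(\<Union>x\<in>K. cball x e) \<subseteq> \<Omega>"
      using compact_subset_open_imp_cball_epsilon_subset[OF K(1) \<Omega> K(2)] by blast
    \<comment> \<open>The closed \<open>e\<close>-neighbourhood of \<open>K\<close>, written as a
      sum of compact sets so that its compactness is immediate.\<close>
    define K' where "K' = (\<Union>x\<in>K. \<Union>y\<in>cball 0 e. {x + y})"
    have sub: "K' \<subseteq> \<Omega>"
      using e by (force simp: K'_def dist_norm)
    have "compact K'"
      unfolding K'_def by (rule compact_sums'[OF K(1) compact_cball])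
    then have "bounded (u ` K')"
      by (intro compact_imp_bounded compact_continuous_image continuous_on_subset[OF u sub])
    then obtain B where B: "B > 0" "\<And>y. y \<in> K' \<Longrightarrow> \<bar>u y\<bar> \<le> B"
      by (auto simp: bounded_pos)
    have "norm p \<le> 2 * B / e" if p: "p \<in> subdifferential_image \<Omega> u K" for p
    proof (cases "p = 0")
      case False
      obtain x where x: "x \<in> K" "\<And>y. y \<in> \<Omega> \<Longrightarrow> u x + p \<bullet> (y - x) \<le> u y"
        using p by (auto simp: mem_subdifferential_image)
      define y where "y = x + (e / norm p) *\<^sub>R p"
      have "x \<in> K'"
        using x(1) e(1) unfolding K'_def by (intro UN_I[of x] UN_I[of 0]) simp_all
      moreover have "y \<in> K'"
        using x(1) e(1) False unfolding K'_def y_def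
        by (intro UN_I[of x] UN_I[of "(e / norm p) *\<^sub>R p"]) simp_all
      ultimately have K': "x \<in> K'" "y \<in> K'" .
      have "p \<bullet> (y - x) = e * norm p"
        using False by (simp add: y_def dot_square_norm power2_eq_square)
      then have "u x + e * norm p \<le> u y"
        using x(2)[of y] K'(2) sub by auto
      then have "e * norm p \<le> 2 * B"
        using B(2)[OF K'(1)] B(2)[OF K'(2)] by linarith
      then show ?thesis
        using e(1) by (simp add: field_simps)
    qed (use B e in auto)
    then show ?thesis
      by (auto simp: bounded_iff)
  qed
  ultimately show ?thesis
    by (simp add: compact_eq_bounded_closed)
qed

section \<open>Almost every slope has at most one contact point\<close>

text \<open>The translates of \<open>S\<close> by multiples of \<open>e\<close> are disjoint and of equal measure, and infinitely
  many of them fit into a bounded set.\<close>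
lemma negligible_if_at_most_one_on_parallel_lines:
  fixes S :: "'a::euclidean_space set"
  assumes S: "compact S"
    and e: "\<And>p t. p \<in> S \<Longrightarrow> t > 0 \<Longrightarrow> p + t *\<^sub>R e \<notin> S"
  shows "negligible S"
proof -
  \<comment> \<open>The shifts 1/(n+1) are distinct and lie in (0,1]: two translates differ by a
    positive multiple of \<open>e\<close>, and all of them stay within distance
    \<open>norm e\<close> of \<open>S\<close>.\<close>
  define T where "T n = (+) ((1 / real (Suc n)) *\<^sub>R e) ` S" for n
  define B where "B = (\<Union>x\<in>S. \<Union>y\<in>cball 0 (norm e). {x + y})"
  have S': "S \<in> lmeasurable"
    using S by (rule lmeasurable_compact)
  have T: "T n \<in> lmeasurable" "measure lebesgue (T n) = measure lebesgue S" for n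
    unfolding T_def using S' by (simp_all only: measurable_translation measure_translation)
  have B: "B \<in> lmeasurable"
    unfolding B_def by (intro lmeasurable_compact compact_sums' S compact_cball)
  have "T n \<subseteq> B" for n
  proof
    fix z assume "z \<in> T n"
    then obtain x where x: "x \<in> S" "z = x + (1 / real (Suc n)) *\<^sub>R e"
      by (auto simp: T_def add.commute)
    have "norm ((1 / real (Suc n)) *\<^sub>R e) \<le> norm e"
      by (simp add: divide_le_eq mult_le_cancel_left1 algebra_simps)
    with x show "z \<in> B"
      unfolding B_def by (intro UN_I[of x] UN_I[of "(1 / real (Suc n)) *\<^sub>R e"]) simp_all
  qed
  have disj: "T m \<inter> T n = {}" if "m < n" for m n
  proof -
    have False if z: "z \<in> T m" "z \<in> T n" for z
    proof -
      obtain x y where xy: "x \<in> S" "y \<in> S" and "z = (1 / real (Suc m)) *\<^sub>R e + x"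
          "z = (1 / real (Suc n)) *\<^sub>R e + y"
        using z unfolding T_def by (elim imageE)
      then have "y = x + (1 / real (Suc m) - 1 / real (Suc n)) *\<^sub>R e"
        by (simp add: algebra_simps)
      moreover have "1 / real (Suc m) - 1 / real (Suc n) > 0"
        using \<open>m < n\<close> by (simp add: frac_less2)
      ultimately show False
        using e xy by blast
    qed
    then show ?thesis by blast
  qed
  have bound: "real n * measure lebesgue S \<le> measure lebesgue B" for n
  proof -
    have "measure lebesgue (\<Union>i\<in>{..<n}. T i) = (\<Sum>i<n. measure lebesgue (T i))"
    proof (rule measure_finite_Union)
      show "disjoint_family_on T {..<n}"
        using disj by (auto simp: disjoint_family_on_def) (metis disjoint_iff linorder_neqE_nat)
      show "T ` {..<n} \<subseteq> sets lebesgue"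
        using T(1) by (intro image_subsetI fmeasurableD)
      show "emeasure lebesgue (T i) \<noteq> \<infinity>" for i
        using fmeasurableD2[OF T(1)] by simp
    qed simp
    also have "\<dots> = real n * measure lebesgue S"
      by (simp add: T)
    finally show ?thesis
      using measure_mono_fmeasurable[of "\<Union>i\<in>{..<n}. T i" B lebesgue] B T \<open>\<And>n. T n \<subseteq> B\<close>
      by (force simp: fmeasurable_def)
  qed
  have "measure lebesgue S = 0"
  proof (rule ccontr)
    assume "measure lebesgue S \<noteq> 0"
    then have pos: "measure lebesgue S > 0"
      by (simp add: zero_less_measure_iff)
    obtain n :: nat where "real n * measure lebesgue S > measure lebesgue B"
      using ex_less_of_nat_mult[OF pos] by blast
    with bound[of n] show False by simp
  qed
  with S' show ?thesis
    by (simp add: negligible_iff_measure)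
qed

text \<open>Monotonicity of the subdifferential: if \<open>p\<close> supports at \<open>y\<close> in
  \<open>L\<close> and \<open>p + t e\<close> with t > 0 supports at \<open>x\<close> in
  \<open>K\<close>, adding the two inequalities gives e.y \<le> e.x, against the separation. So the
  common slopes meet each line parallel to \<open>e\<close> at most once.\<close>

lemma negligible_Int_subdifferential_image:
  fixes u :: "real ^ 'n \<Rightarrow> real"
  assumes \<Omega>: "open \<Omega>" and u: "continuous_on \<Omega> u"
    and K: "compact K" "K \<subseteq> \<Omega>" and L: "compact L" "L \<subseteq> \<Omega>"
    and sep: "\<And>x y. x \<in> K \<Longrightarrow> y \<in> L \<Longrightarrow> e \<bullet> x < e \<bullet> y"
  shows "negligible (subdifferential_image \<Omega> u K \<inter> subdifferential_image \<Omega> u L)"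
proof (rule negligible_if_at_most_one_on_parallel_lines)
  show "compact (subdifferential_image \<Omega> u K \<inter> subdifferential_image \<Omega> u L)"
    by (intro compact_Int compact_subdifferential_image assms)
next
  fix p and t :: real
  assume p: "p \<in> subdifferential_image \<Omega> u K \<inter> subdifferential_image \<Omega> u L" and "t > 0"
  show "p + t *\<^sub>R e \<notin> subdifferential_image \<Omega> u K \<inter> subdifferential_image \<Omega> u L"
  proof
    assume q: "p + t *\<^sub>R e \<in> subdifferential_image \<Omega> u K \<inter> subdifferential_image \<Omega> u L"
    obtain y where y: "y \<in> L" "\<And>z. z \<in> \<Omega> \<Longrightarrow> u y + p \<bullet> (z - y) \<le> u z"
      using p by (auto simp: mem_subdifferential_image)
    obtain x where x: "x \<in> K" "\<And>z. z \<in> \<Omega> \<Longrightarrow> u x + (p + t *\<^sub>R e) \<bullet> (z - x) \<le> u z"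
      using q unfolding Int_iff mem_subdifferential_image by blast
    have "t * (e \<bullet> y - e \<bullet> x) \<le> 0"
      using y(2)[of x] x(2)[of y] x(1) y(1) K(2) L(2) by (force simp: algebra_simps inner_simps)
    then show False
      using sep[OF x(1) y(1)] \<open>t > 0\<close> by (simp add: mult_le_0_iff)
  qed
qed

text \<open>Distinct points differ in some coordinate, so rationals separate them. With a compact
  exhaustion of \<Omega> this covers the overlap by countably many intersections of the kind just
  treated.\<close>

lemma negligible_subdifferential_overlap:
  fixes u :: "real ^ 'n \<Rightarrow> real"
  assumes \<Omega>: "open \<Omega>" and u: "continuous_on \<Omega> u"
  shows "negligible {p. \<exists>x\<in>\<Omega>. \<exists>y\<in>\<Omega>. x \<noteq> y \<and> p \<in> subdifferential \<Omega> u x \<and> p \<in> subdifferential \<Omega> u y}"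
    (is "negligible ?N")
proof -
  obtain C where C: "\<And>n::nat. compact (C n)" "\<And>n. C n \<subseteq> \<Omega>" "\<Union>(range C) = \<Omega>"
    using open_Union_compact_subsets[OF \<Omega>] by metis
  \<comment> \<open>Two levels a < b instead of one keep both pieces compact and still strictly
    separated in coordinate \<open>i\<close>.\<close>
  define D where "D = (\<lambda>(m, n, i, a, b).
    subdifferential_image \<Omega> u (C m \<inter> {x. axis i 1 \<bullet> x \<le> a}) \<inter>
    subdifferential_image \<Omega> u (C n \<inter> {x. axis i 1 \<bullet> x \<ge> b}))"
  define I where "I = {(m :: nat, n :: nat, i :: 'n, a :: real, b :: real) |m n i a b. a \<in> \<rat> \<and> b \<in> \<rat> \<and> a < b}"
  have "I \<subseteq> UNIV \<times> UNIV \<times> UNIV \<times> \<rat> \<times> \<rat>"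
    by (auto simp: I_def)
  moreover have "countable (UNIV \<times> UNIV \<times> UNIV \<times> \<rat> \<times> \<rat> :: (nat \<times> nat \<times> 'n \<times> real \<times> real) set)"
    by (intro countable_SIGMA countable_rat) (auto intro: countable_finite)
  ultimately have "countable (D ` I)"
    by (meson countable_image countable_subset)
  moreover have "negligible S" if S: "S \<in> D ` I" for S
  proof -
    obtain m n i and a b :: real where S: "S = D (m, n, i, a, b)" "a < b"
      using S unfolding I_def by blast
    show ?thesis
      unfolding S(1) D_def prod.case
      by (rule negligible_Int_subdifferential_image[OF \<Omega> u, where e = "axis i 1"])
        (use C S(2) in \<open>auto intro!: compact_Int_closed closed_halfspace_le closed_halfspace_ge\<close>)
  qed
  ultimately have "negligible (\<Union>(D ` I))"
    by (rule negligible_countable_Union)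
  moreover have "?N \<subseteq> \<Union>(D ` I)"
  proof
    fix p assume "p \<in> ?N"
    then obtain x y where xy: "x \<in> \<Omega>" "y \<in> \<Omega>" "x \<noteq> y"
      and p: "p \<in> subdifferential \<Omega> u x" "p \<in> subdifferential \<Omega> u y"
      by blast
    have *: "p \<in> \<Union>(D ` I)" if xy: "x \<in> \<Omega>" "y \<in> \<Omega>" "x $ i < y $ i"
      and p: "p \<in> subdifferential \<Omega> u x" "p \<in> subdifferential \<Omega> u y" for x y i
    proof -
      obtain m n where mn: "x \<in> C m" "y \<in> C n"
        using C(3) xy by blast
      obtain a where a: "a \<in> \<rat>" "x $ i < a" "a < y $ i"
        using Rats_dense_in_real[OF xy(3)] by blast
      obtain b where b: "b \<in> \<rat>" "a < b" "b < y $ i"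
        using Rats_dense_in_real[OF a(3)] by blast
      have "(m, n, i, a, b) \<in> I"
        using a b by (auto simp: I_def)
      moreover have "p \<in> D (m, n, i, a, b)"
        using mn p a b by (auto simp: D_def subdifferential_image_def inner_axis')
      ultimately show ?thesis by blast
    qed
    obtain i where "x $ i \<noteq> y $ i"
      using xy(3) by (auto simp: vec_eq_iff)
    then consider "x $ i < y $ i" | "y $ i < x $ i"
      by linarith
    then show "p \<in> \<Union>(D ` I)"
      using * xy p by cases blast+
  qed
  ultimately show ?thesis
    by (rule negligible_subset)
qed

section \<open>The Monge-Ampere set function is a measure\<close>

text \<open>Off the null set where the subdifferentials overlap, every slope \<open>p\<close> belongs to a unique
  point \<open>g p\<close>, so the Monge-Ampere measure is the image of Lebesgue measure under \<open>g\<close>.\<close>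
lemma subdifferential_image_distr:
  fixes u :: "real ^ 'n \<Rightarrow> real"
  assumes \<Omega>: "open \<Omega>" and u: "continuous_on \<Omega> u"
  obtains D :: "(real ^ 'n) measure" where "sets D = sets borel"
    and "\<And>E. E \<in> sets borel \<Longrightarrow> E \<subseteq> \<Omega> \<Longrightarrow>
      emeasure D E = emeasure lebesgue (subdifferential_image \<Omega> u E)"
    and "\<And>E. E \<in> sets borel \<Longrightarrow> E \<subseteq> \<Omega> \<Longrightarrow> subdifferential_image \<Omega> u E \<in> sets lebesgue"
proof -
  define N where "N = {p. \<exists>x\<in>\<Omega>. \<exists>y\<in>\<Omega>. x \<noteq> y \<and> p \<in> subdifferential \<Omega> u x \<and> p \<in> subdifferential \<Omega> u y}"
  have N: "N \<in> null_sets lebesgue"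
    using negligible_subdifferential_overlap[OF assms] by (simp add: N_def negligible_iff_null_sets)
  define S where "S = subdifferential_image \<Omega> u \<Omega> - N"
  define g where "g p = (SOME x. x \<in> \<Omega> \<and> p \<in> subdifferential \<Omega> u x)" for p
  have g: "g p = x" if "p \<notin> N" "x \<in> \<Omega>" "p \<in> subdifferential \<Omega> u x" for p x
    unfolding g_def using that by (intro some_equality) (auto simp: N_def)
  \<comment> \<open>Preimages under \<open>g\<close> are slope sets up to the null set
    \<open>N\<close>, so measurability of \<open>g\<close> can be checked on closed sets, where
    slope sets are accessible.\<close>
  have image: "g -` E \<inter> S = subdifferential_image \<Omega> u (E \<inter> \<Omega>) - N" for E
    using g by (fastforce simp: S_def subdifferential_image_def)
  obtain C where C: "\<And>n::nat. compact (C n)" "\<And>n. C n \<subseteq> \<Omega>" "\<Union>(range C) = \<Omega>"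
    using open_Union_compact_subsets[OF \<Omega>] by metis
  \<comment> \<open>A relatively closed subset of \<Omega> is a countable union of compact sets,
    hence so is its slope set.\<close>
  have closed: "subdifferential_image \<Omega> u (F \<inter> \<Omega>) \<in> sets lebesgue" if "closed F" for F
  proof -
    have "F \<inter> \<Omega> = (\<Union>n. F \<inter> C n)"
      using C(3) by auto
    moreover have "subdifferential_image \<Omega> u (F \<inter> C n) \<in> sets lebesgue" for n
      by (intro fmeasurableD lmeasurable_compact compact_subdifferential_image[OF assms]
          closed_Int_compact that C) (use C(2) in blast)
    ultimately show ?thesis
      by (simp only: subdifferential_image_UN) blast
  qed
  have S: "S \<in> sets lebesgue"
    using closed[of UNIV] N by (auto simp: S_def)
  have meas: "g \<in> borel_measurable (restrict_space lebesgue S)"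
    unfolding borel_eq_closed
  proof (rule measurable_measure_of)
    fix F :: "(real ^ 'n) set" assume "F \<in> Collect closed"
    then have "g -` F \<inter> S \<in> sets lebesgue"
      unfolding image using closed N by auto
    then show "g -` F \<inter> space (restrict_space lebesgue S) \<in> sets (restrict_space lebesgue S)"
      using S by (simp add: space_restrict_space sets_restrict_space_iff)
  qed auto
  show thesis
  proof
    show "sets (distr (restrict_space lebesgue S) borel g) = sets borel"
      by simp
    fix E :: "(real ^ 'n) set" assume E: "E \<in> sets borel" "E \<subseteq> \<Omega>"
    have pre: "g -` E \<inter> S = subdifferential_image \<Omega> u E - N"
      using image[of E] E(2) by (simp add: inf.absorb1)
    have "subdifferential_image \<Omega> u E - N \<in> sets lebesgue"
      using measurable_sets[OF meas E(1)] S
      by (simp add: space_restrict_space sets_restrict_space_iff pre)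
    \<comment> \<open>Completeness of Lebesgue measure makes the part inside \<open>N\<close>
      measurable, so it can be put back.\<close>
    then have "(subdifferential_image \<Omega> u E - N) \<union> (subdifferential_image \<Omega> u E \<inter> N) \<in> sets lebesgue"
      using N negligible_subset[of N] by (metis Int_lower2 negligible_iff_null_sets null_setsD2 sets.Un)
    then show "subdifferential_image \<Omega> u E \<in> sets lebesgue"
      by (simp add: Un_Diff_Int)
    moreover have "emeasure (distr (restrict_space lebesgue S) borel g) E
        = emeasure lebesgue (subdifferential_image \<Omega> u E - N)"
      using S by (subst emeasure_distr[OF meas E(1)])
        (simp add: space_restrict_space pre, subst emeasure_restrict_space, auto simp: S_def subdifferential_image_def dest: subsetD[OF E(2)])
    ultimately show "emeasure (distr (restrict_space lebesgue S) borel g) E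
        = emeasure lebesgue (subdifferential_image \<Omega> u E)"
      using N by (simp add: emeasure_Diff_null_set)
  qed
qed

lemma sets_monge_ampere:
  assumes "open \<Omega>"
  shows "sets (monge_ampere \<Omega> u) = {E. E \<in> sets borel \<and> E \<subseteq> \<Omega>}"
proof -
  have eq: "{E. E \<in> sets borel \<and> E \<subseteq> \<Omega>} = sets (restrict_space borel \<Omega>)"
    using assms by (auto simp: sets_restrict_space_iff)
  have "sigma_algebra \<Omega> {E. E \<in> sets borel \<and> E \<subseteq> \<Omega>}"
    unfolding eq using sets.sigma_algebra_axioms[of "restrict_space borel \<Omega>"]
    by (simp add: space_restrict_space)
  then show "sets (monge_ampere \<Omega> u) = {E. E \<in> sets borel \<and> E \<subseteq> \<Omega>}"
    unfolding monge_ampere_def by (rule sigma_algebra.sets_measure_of_eq)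
qed

text \<open>Rules out the default null measure of \<open>measure_of\<close>: on Borel subsets of
  \<Omega> the set function agrees with the genuine measure \<open>D\<close> and inherits countable
  additivity from it.\<close>

lemma emeasure_monge_ampere:
  fixes u :: "real ^ 'n \<Rightarrow> real"
  assumes \<Omega>: "open \<Omega>" and u: "continuous_on \<Omega> u" and E: "E \<in> sets borel" "E \<subseteq> \<Omega>"
  shows "emeasure (monge_ampere \<Omega> u) E = emeasure lebesgue (subdifferential_image \<Omega> u E)"
proof -
  obtain D :: "(real ^ 'n) measure" where D: "sets D = sets borel" "\<And>E. E \<in> sets borel \<Longrightarrow> E \<subseteq> \<Omega> \<Longrightarrow>
      emeasure D E = emeasure lebesgue (subdifferential_image \<Omega> u E)"
    by (rule subdifferential_image_distr[OF \<Omega> u]) blast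
  show ?thesis
  proof (rule emeasure_measure_of[OF monge_ampere_def])
    show "{E. E \<in> sets borel \<and> E \<subseteq> \<Omega>} \<subseteq> Pow \<Omega>"
      by auto
    show "E \<in> sets (monge_ampere \<Omega> u)"
      using E by (simp add: sets_monge_ampere[OF \<Omega>])
    show "positive (sets (monge_ampere \<Omega> u)) (\<lambda>E. emeasure lebesgue (subdifferential_image \<Omega> u E))"
      by (simp add: positive_def subdifferential_image_def)
    show "countably_additive (sets (monge_ampere \<Omega> u)) (\<lambda>E. emeasure lebesgue (subdifferential_image \<Omega> u E))"
      unfolding countably_additive_def
    proof (intro allI impI)
      fix A :: "nat \<Rightarrow> _"
      assume A: "range A \<subseteq> sets (monge_ampere \<Omega> u)" "disjoint_family A"
        and un: "\<Union>(range A) \<in> sets (monge_ampere \<Omega> u)"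
      have A': "A i \<in> sets borel" "A i \<subseteq> \<Omega>" for i
        using A(1) by (auto simp: sets_monge_ampere[OF \<Omega>])
      have "(\<Sum>i. emeasure D (A i)) = emeasure D (\<Union>(range A))"
        using A A' by (intro suminf_emeasure) (auto simp: D)
      then show "(\<Sum>i. emeasure lebesgue (subdifferential_image \<Omega> u (A i)))
          = emeasure lebesgue (subdifferential_image \<Omega> u (\<Union>(range A)))"
        using A' un by (simp add: D sets_monge_ampere[OF \<Omega>])
    qed
  qed
qed

section \<open>The weighted measure and its bounds\<close>

lemma emeasure_exp_monge_ampere:
  fixes u :: "real ^ 'n \<Rightarrow> real"
  assumes \<Omega>: "open \<Omega>" and u: "continuous_on \<Omega> u" and E: "E \<in> sets borel" "E \<subseteq> \<Omega>"
  shows "emeasure (exp_monge_ampere \<Omega> u) E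
    = (\<integral>\<^sup>+ x. ennreal (exp (- u x)) * indicator E x \<partial>monge_ampere \<Omega> u)"
  unfolding exp_monge_ampere_def
proof (rule emeasure_density)
  \<comment> \<open>Continuity is given on \<Omega> alone, so measurability is obtained on the
    restricted Borel space, which has the same measurable sets.\<close>
  have "(\<lambda>x. ennreal (exp (- u x))) \<in> borel_measurable (restrict_space borel \<Omega>)"
    using borel_measurable_continuous_on_restrict[OF u] by measurable
  moreover have "sets (monge_ampere \<Omega> u) = sets (restrict_space borel \<Omega>)"
    using \<Omega> by (auto simp: sets_restrict_space_iff sets_monge_ampere)
  ultimately show "(\<lambda>x. ennreal (exp (- u x))) \<in> borel_measurable (monge_ampere \<Omega> u)"
    by (simp cong: measurable_cong_sets)
qed (use E in \<open>simp add: sets_monge_ampere[OF \<Omega>]\<close>)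

lemma exp_monge_ampere_bounds:
  fixes u :: "real ^ 'n \<Rightarrow> real"
  assumes \<Omega>: "open \<Omega>" and u: "continuous_on \<Omega> u" and E: "E \<in> sets borel" "E \<subseteq> \<Omega>"
  shows "(\<And>x. x \<in> E \<Longrightarrow> a \<le> u x) \<Longrightarrow> emeasure (exp_monge_ampere \<Omega> u) E
      \<le> ennreal (exp (- a)) * emeasure lebesgue (subdifferential_image \<Omega> u E)"
    and "(\<And>x. x \<in> E \<Longrightarrow> u x \<le> b) \<Longrightarrow> ennreal (exp (- b)) * emeasure lebesgue (subdifferential_image \<Omega> u E)
      \<le> emeasure (exp_monge_ampere \<Omega> u) E"
proof -
  have *: "ennreal (exp c) * emeasure lebesgue (subdifferential_image \<Omega> u E)
      = (\<integral>\<^sup>+ x. ennreal (exp c) * indicator E x \<partial>monge_ampere \<Omega> u)" for c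
    using E by (simp add: nn_integral_cmult_indicator emeasure_monge_ampere[OF assms] sets_monge_ampere[OF \<Omega>])
  show "emeasure (exp_monge_ampere \<Omega> u) E
      \<le> ennreal (exp (- a)) * emeasure lebesgue (subdifferential_image \<Omega> u E)" if "\<And>x. x \<in> E \<Longrightarrow> a \<le> u x"
    unfolding * emeasure_exp_monge_ampere[OF assms]
    using that by (intro nn_integral_mono) (auto simp: indicator_def)
  show "ennreal (exp (- b)) * emeasure lebesgue (subdifferential_image \<Omega> u E)
      \<le> emeasure (exp_monge_ampere \<Omega> u) E" if "\<And>x. x \<in> E \<Longrightarrow> u x \<le> b"
    unfolding * emeasure_exp_monge_ampere[OF assms]
    using that by (intro nn_integral_mono) (auto simp: indicator_def)
qed

section \<open>Existence of supporting planes and touching from below\<close>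

text \<open>Separate the graph point over \<open>x0\<close> from the strict epigraph by a hyperplane
  with normal \<open>(q, s)\<close>. Once s < 0 is known, dividing by \<open>- s\<close> turns it
  into a supporting plane.\<close>

lemma convex_on_subdifferential_nonempty:
  fixes u :: "real ^ 'n \<Rightarrow> real"
  assumes \<Omega>: "open \<Omega>" and u: "convex_on \<Omega> u" and x0: "x0 \<in> \<Omega>"
  obtains p where "p \<in> subdifferential \<Omega> u x0"
proof -
  define S where "S = {z. fst z \<in> \<Omega> \<and> u (fst z) < snd z}"
  have "convex S"
    unfolding convex_def
  proof (intro ballI allI impI)
    fix z w and s t :: real assume zw: "z \<in> S" "w \<in> S" and st: "0 \<le> s" "0 \<le> t" "s + t = 1"
    have "s *\<^sub>R fst z + t *\<^sub>R fst w \<in> \<Omega>"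
      using u zw st by (auto simp: S_def convex_on_def convex_def)
    moreover have "u (s *\<^sub>R fst z + t *\<^sub>R fst w) \<le> s * u (fst z) + t * u (fst w)"
      using u zw st by (auto simp: S_def convex_on_def)
    moreover have "s * u (fst z) + t * u (fst w) < s * snd z + t * snd w"
    \<comment> \<open>One positive weight is enough for strictness; if s = 0 then t = 1 and it comes
      from \<open>w\<close>.\<close>
    proof (cases "s = 0")
      case False
      then have "s * u (fst z) < s * snd z" "t * u (fst w) \<le> t * snd w"
        using zw st by (auto simp: S_def intro: mult_left_mono)
      then show ?thesis by linarith
    qed (use zw st in \<open>auto simp: S_def\<close>)
    ultimately show "s *\<^sub>R z + t *\<^sub>R w \<in> S"
      by (simp add: S_def)
  qed
  moreover have "(x0, u x0 + 1) \<in> S" "S \<inter> {(x0, u x0)} = {}"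
    using x0 by (auto simp: S_def)
  ultimately obtain a b where ab: "a \<noteq> 0" "\<forall>z\<in>S. a \<bullet> z \<le> b" "b \<le> a \<bullet> (x0, u x0)"
    using separating_hyperplane_sets[of S "{(x0, u x0)}"] by (metis convex_singleton empty_iff insert_not_empty singletonI)
  define q s where "q = fst a" and "s = snd a"
  have le: "q \<bullet> x + s * t \<le> q \<bullet> x0 + s * u x0" if "x \<in> \<Omega>" "t > u x" for x t
  proof -
    have "(x, t) \<in> S"
      using that by (simp add: S_def)
    then have "a \<bullet> (x, t) \<le> a \<bullet> (x0, u x0)"
      using ab(2,3) order.trans by blast
    then show ?thesis
      by (simp add: q_def s_def inner_prod_def)
  qed
  have "s \<le> 0"
    using le[OF x0, of "u x0 + 1"] by (simp add: algebra_simps)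
  moreover have "s \<noteq> 0"
  \<comment> \<open>A vertical hyperplane would give q.x \<le> q.x0 throughout \<Omega>, which fails
    on stepping from the interior point \<open>x0\<close> in the direction \<open>q\<close>.\<close>
  proof
    assume s: "s = 0"
    then have "q \<noteq> 0"
      using ab(1) by (auto simp: q_def s_def zero_prod_def prod_eq_iff)
    obtain e where e: "e > 0" "cball x0 e \<subseteq> \<Omega>"
      using \<Omega> x0 open_contains_cball by blast
    have "x0 + (e / norm q) *\<^sub>R q \<in> \<Omega>"
      using e \<open>q \<noteq> 0\<close> by (auto intro!: subsetD[OF e(2)] simp: dist_norm)
    then have "(e / norm q) * (q \<bullet> q) \<le> 0"
      using le[of "x0 + (e / norm q) *\<^sub>R q" "u (x0 + (e / norm q) *\<^sub>R q) + 1"] s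
      by (simp add: inner_simps)
    then show False
      using e \<open>q \<noteq> 0\<close> by (simp add: mult_le_0_iff divide_le_0_iff flip: not_less)
  qed
  ultimately have "s < 0" by simp
  have "u x0 + (q /\<^sub>R (- s)) \<bullet> (x - x0) \<le> u x" if "x \<in> \<Omega>" for x
  \<comment> \<open>The strict epigraph contains only heights above \<open>u x\<close>, so the
    height \<open>u x\<close> itself is reached as a limit.\<close>
  proof (rule field_le_epsilon)
    fix d :: real assume "d > 0"
    with le[OF that, of "u x + d"] \<open>s < 0\<close>
    show "u x0 + (q /\<^sub>R (- s)) \<bullet> (x - x0) \<le> u x + d"
      by (simp add: inner_simps field_simps)
  qed
  then show thesis
    by (intro that[of "q /\<^sub>R (- s)"]) (simp add: subdifferential_def)
qed

text \<open>The minimum of \<open>v - p\<close> over \<open>K\<close> is attained in \<open>A\<close>, where it is a local and hence a global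
  minimum.\<close>
lemma subdifferential_image_if_interior_min:
  fixes v :: "real ^ 'n \<Rightarrow> real"
  assumes v: "convex_on \<Omega> v" "continuous_on K v" and K: "compact K" and A: "open A" "A \<subseteq> K" "A \<subseteq> \<Omega>"
    and x: "x \<in> A" and bd: "\<And>z. z \<in> K - A \<Longrightarrow> v x - p \<bullet> x < v z - p \<bullet> z"
  shows "p \<in> subdifferential_image \<Omega> v A"
proof -
  have "continuous_on K (\<lambda>z. v z - p \<bullet> z)"
    by (intro continuous_intros v)
  moreover have "K \<noteq> {}"
    using x A by blast
  ultimately obtain z where z: "z \<in> K" "\<And>y. y \<in> K \<Longrightarrow> v z - p \<bullet> z \<le> v y - p \<bullet> y"
    using continuous_attains_inf[OF K] by blast
  have "z \<in> A"
    using bd[of z] z x A by force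
  obtain e where e: "e > 0" "ball z e \<subseteq> A"
    using A(1) \<open>z \<in> A\<close> openE by blast
  have "convex_on \<Omega> (\<lambda>y. v y + (- p) \<bullet> y)"
    using v(1) by (auto simp: convex_on_def algebra_simps inner_simps)
  then have "\<forall>y\<in>\<Omega>. v z + (- p) \<bullet> z \<le> v y + (- p) \<bullet> y"
  proof (rule convex_local_global_minimum[OF e(1)])
    show "ball z e \<subseteq> \<Omega>"
      using e(2) A(3) by (rule subset_trans)
    show "\<forall>y\<in>ball z e. v z + (- p) \<bullet> z \<le> v y + (- p) \<bullet> y"
      using e(2) A(2) z(2) by (simp add: subset_iff)
  qed
  then show ?thesis
    using \<open>z \<in> A\<close> by (auto simp: mem_subdifferential_image inner_simps algebra_simps)
qed

section \<open>The comparison argument\<close>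

theorem lemma2p13:
  fixes \<Omega> :: "(real ^ 'n) set" and u v :: "real ^ 'n \<Rightarrow> real" and x0 :: "real ^ 'n"
  assumes "open \<Omega>"
    and "convex_on \<Omega> u" and "convex_on \<Omega> v"
    and "\<And>E. E \<in> sets borel \<Longrightarrow> E \<subseteq> \<Omega> \<Longrightarrow>
           emeasure (exp_monge_ampere \<Omega> u) E \<ge> emeasure (exp_monge_ampere \<Omega> v) E"
    and "strict_local_max_at \<Omega> (\<lambda>x. u x - v x) x0"
  shows "u x0 \<le> v x0"
proof (rule ccontr)
  assume "\<not> u x0 \<le> v x0"
  define m where "m = u x0 - v x0"
  have "m > 0"
    using \<open>\<not> u x0 \<le> v x0\<close> by (simp add: m_def)
  note \<Omega> = \<open>open \<Omega>\<close>
  have cu: "continuous_on \<Omega> u" and cv: "continuous_on \<Omega> v"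
    using assms convex_on_continuous by blast+
  obtain R where x0: "x0 \<in> \<Omega>" and R: "R > 0" "\<And>x. x \<in> \<Omega> \<Longrightarrow> dist x0 x < R \<Longrightarrow> x \<noteq> x0 \<Longrightarrow> u x - v x < m"
    using assms(5) by (auto simp: strict_local_max_at_def m_def)
  have "isCont u x0" "isCont v x0"
    using \<Omega> cu cv x0 continuous_on_eq_continuous_at by blast+
  \<comment> \<open>Oscillations below m/3 for each function use up 2m/3 of the gap
    \<open>m\<close>; the remaining m/3 yields the strict inequality between the exponential
    factors.\<close>
  then have "\<forall>\<^sub>F x in nhds x0. dist (u x) (u x0) < m / 3 \<and> dist (v x) (v x0) < m / 3 \<and> x \<in> \<Omega>"
    using \<open>m > 0\<close> \<Omega> x0
    by (intro eventually_conj tendstoD eventually_nhds_in_open) (auto simp: isCont_def tendsto_at_iff_tendsto_nhds)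
  then obtain r' where r': "r' > 0" "\<And>x. dist x x0 < r' \<Longrightarrow>
      dist (u x) (u x0) < m / 3 \<and> dist (v x) (v x0) < m / 3 \<and> x \<in> \<Omega>"
    by (auto simp: eventually_nhds_metric)
  define r where "r = min R r' / 2"
  have "r > 0" and sub: "cball x0 r \<subseteq> \<Omega>"
    and osc: "\<And>x. x \<in> cball x0 r \<Longrightarrow> \<bar>u x - u x0\<bar> < m / 3 \<and> \<bar>v x - v x0\<bar> < m / 3"
    and max: "\<And>x. x \<in> cball x0 r \<Longrightarrow> x \<noteq> x0 \<Longrightarrow> u x - v x < m"
    using R r' by (auto simp: r_def dist_real_def dist_commute subset_iff)
  have cuB: "continuous_on (cball x0 r) u" and cvB: "continuous_on (cball x0 r) v"
    using cu cv sub continuous_on_subset by blast+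
  \<comment> \<open>\<open>c\<close> is the maximum of \<open>u - v\<close> on the sphere; it is
    attained, so strictness of the local maximum gives c < m.\<close>
  obtain c where "c < m" and c: "\<And>x. x \<in> sphere x0 r \<Longrightarrow> u x - v x \<le> c"
  proof -
    have "continuous_on (sphere x0 r) (\<lambda>x. u x - v x)"
      using cuB cvB by (intro continuous_intros) (auto elim: continuous_on_subset)
    moreover have "sphere x0 r \<noteq> {}"
      using \<open>r > 0\<close> by simp
    ultimately obtain z where "z \<in> sphere x0 r" "\<forall>x\<in>sphere x0 r. u x - v x \<le> u z - v z"
      using continuous_attains_sup[of "sphere x0 r" "\<lambda>x. u x - v x"] compact_sphere by blast
    then show thesis
      using that[of "u z - v z"] max[of z] \<open>r > 0\<close> by auto
  qed
  define A where "A = {x \<in> ball x0 r. c < u x - v x}"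
  define K where "K = {x \<in> cball x0 r. c \<le> u x - v x}"
  have "continuous_on (ball x0 r) (\<lambda>x. u x - v x)"
    using cuB cvB by (intro continuous_intros) (auto elim: continuous_on_subset)
  then have "open (ball x0 r \<inter> (\<lambda>x. u x - v x) -` {c<..})"
    by (rule continuous_open_preimage) auto
  then have A: "open A"
    by (simp add: A_def vimage_def Int_def)
  have "closed (cball x0 r \<inter> (\<lambda>x. u x - v x) -` {c..})"
    by (intro continuous_closed_preimage continuous_intros cuB cvB closed_cball closed_atLeast)
  then have "closed K"
    by (simp add: K_def vimage_def Int_def)
  moreover have "bounded K"
    by (rule bounded_subset[OF bounded_cball]) (auto simp: K_def)
  ultimately have K: "compact K"
    by (simp add: compact_eq_bounded_closed)
  have AK: "A \<subseteq> K" and KB: "K \<subseteq> cball x0 r" and A\<Omega>: "A \<subseteq> \<Omega>"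
    using sub by (auto simp: A_def K_def)
  \<comment> \<open>On the sphere the choice of \<open>c\<close> gives u - v \<le> c; inside the
    ball this is failure of membership in \<open>A\<close>. Membership in \<open>K\<close> gives the
    reverse.\<close>
  have bd: "u z - v z = c" if "z \<in> K - A" for z
    using that c[of z] by (cases "z \<in> sphere x0 r") (auto simp: A_def K_def)
  have x0A: "x0 \<in> A"
    using \<open>r > 0\<close> \<open>c < m\<close> by (simp add: A_def m_def)
  have cvK: "continuous_on K v"
    using cvB KB continuous_on_subset by blast
  note criterion = subdifferential_image_if_interior_min[OF assms(3) cvK K A AK A\<Omega>]

  \<comment> \<open>A supporting plane of \<open>u\<close> at \<open>x\<close> in \<open>A\<close>,
    lowered by \<open>c\<close>, lies below v = u - c on \<open>K - A\<close> but strictly above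
    \<open>v\<close> at \<open>x\<close>. This is the strict inequality that
    \<open>criterion\<close> asks for.\<close>
  have incl: "subdifferential_image \<Omega> u A \<subseteq> subdifferential_image \<Omega> v A"
  proof
    fix p assume "p \<in> subdifferential_image \<Omega> u A"
    then obtain x where x: "x \<in> A" "\<And>y. y \<in> \<Omega> \<Longrightarrow> u x + p \<bullet> (y - x) \<le> u y"
      by (auto simp: mem_subdifferential_image)
    show "p \<in> subdifferential_image \<Omega> v A"
    proof (rule criterion[OF x(1)])
      fix z assume z: "z \<in> K - A"
      then have "z \<in> \<Omega>"
        using KB sub by blast
      then show "v x - p \<bullet> x < v z - p \<bullet> z"
        using x(2)[of z] bd[OF z] x(1) by (simp add: A_def inner_simps)
    qed
  qed

  obtain p0 where "p0 \<in> subdifferential \<Omega> u x0"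
    using convex_on_subdifferential_nonempty[OF \<Omega> assms(2) x0] .
  then have p0: "\<And>y. y \<in> \<Omega> \<Longrightarrow> u x0 + p0 \<bullet> (y - x0) \<le> u y"
    by (simp add: subdifferential_def)
  \<comment> \<open>At \<open>x0\<close> the plane with slope \<open>p0\<close>, lowered by
    \<open>c\<close>, exceeds \<open>v\<close> by \<open>m - c\<close>. Changing the slope to
    \<open>p\<close> while fixing the value at \<open>x0\<close> alters the plane on the ball by at
    most \<open>norm (p - p0) * r\<close>, which the radius keeps below that excess.\<close>
  have ball: "ball p0 ((m - c) / r) \<subseteq> subdifferential_image \<Omega> v A"
  proof
    fix p assume p: "p \<in> ball p0 ((m - c) / r)"
    show "p \<in> subdifferential_image \<Omega> v A"
    proof (rule criterion[OF x0A])
      fix z assume z: "z \<in> K - A"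
      then have "z \<in> \<Omega>" and zr: "norm (z - x0) \<le> r"
        using KB sub by (auto simp: dist_norm norm_minus_commute)
      have "(p - p0) \<bullet> (z - x0) \<le> norm (p - p0) * norm (z - x0)"
        by (rule norm_cauchy_schwarz)
      also have "\<dots> \<le> norm (p - p0) * r"
        using zr by (rule mult_left_mono) simp
      also have "\<dots> < m - c"
        using p \<open>r > 0\<close> by (simp add: dist_norm norm_minus_commute field_simps)
      finally show "v x0 - p \<bullet> x0 < v z - p \<bullet> z"
        using p0[OF \<open>z \<in> \<Omega>\<close>] bd[OF z] by (simp add: inner_simps m_def)
    qed
  qed

  define U where "U = emeasure lebesgue (subdifferential_image \<Omega> u A)"
  define V where "V = emeasure lebesgue (subdifferential_image \<Omega> v A)"
  have Ab: "A \<in> sets borel"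
    using A by simp
  have oscA: "u x0 - m / 3 \<le> u x" "v x \<le> v x0 + m / 3" if "x \<in> A" for x
  proof -
    have "x \<in> cball x0 r"
      using AK KB that by blast
    then show "u x0 - m / 3 \<le> u x" "v x \<le> v x0 + m / 3"
      using osc[of x] by linarith+
  qed
  \<comment> \<open>Monotonicity of \<open>emeasure\<close> requires the larger set to be
    measurable, as nonmeasurable sets get the value 0.\<close>
  have meas: "subdifferential_image \<Omega> v A \<in> sets lebesgue"
    using subdifferential_image_distr[OF \<Omega> cv] Ab A\<Omega> by blast
  have "U \<le> V"
    unfolding U_def V_def using incl meas by (rule emeasure_mono)
  have "V < \<infinity>"
  proof -
    have "subdifferential_image \<Omega> v A \<subseteq> subdifferential_image \<Omega> v K"
      using AK by (auto simp: subdifferential_image_def)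
    moreover have KL: "subdifferential_image \<Omega> v K \<in> lmeasurable"
      using KB sub by (intro lmeasurable_compact compact_subdifferential_image \<Omega> cv K) blast
    ultimately have "V \<le> emeasure lebesgue (subdifferential_image \<Omega> v K)"
      unfolding V_def by (intro emeasure_mono) auto
    also have "\<dots> < \<infinity>"
      using KL by (rule fmeasurableD2[THEN top.not_eq_extremum[THEN iffD1], folded infinity_ennreal_def])
    finally show ?thesis .
  qed
  have "V > 0"
  proof -
    have "0 < emeasure lebesgue (ball p0 ((m - c) / r))"
      using \<open>c < m\<close> \<open>r > 0\<close> content_ball_pos[of "(m - c) / r" p0]
      by (simp add: measure_def enn2real_positive_iff)
    also have "\<dots> \<le> V"
      unfolding V_def using ball meas by (rule emeasure_mono)
    finally show ?thesis .
  qed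
  have "ennreal (exp (- (v x0 + m / 3))) * V \<le> emeasure (exp_monge_ampere \<Omega> v) A"
    unfolding V_def by (rule exp_monge_ampere_bounds[OF \<Omega> cv Ab A\<Omega>])
      (rule oscA)
  also have "\<dots> \<le> emeasure (exp_monge_ampere \<Omega> u) A"
    using Ab A\<Omega> by (rule assms(4))
  also have "\<dots> \<le> ennreal (exp (- (u x0 - m / 3))) * U"
    unfolding U_def by (rule exp_monge_ampere_bounds[OF \<Omega> cu Ab A\<Omega>])
      (rule oscA)
  also have "\<dots> \<le> ennreal (exp (- (u x0 - m / 3))) * V"
    using \<open>U \<le> V\<close> by (rule mult_left_mono) simp
  \<comment> \<open>The exponents compare strictly because m > 2m/3; strictness survives
    multiplication by \<open>V\<close> since \<open>V\<close> is positive and finite.\<close>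
  also have "\<dots> < ennreal (exp (- (v x0 + m / 3))) * V"
  proof -
    obtain w where w: "V = ennreal w" "w > 0"
      using \<open>V < \<infinity>\<close> \<open>V > 0\<close> by (cases V) (auto simp: ennreal_zero_less_top)
    have "u x0 - m / 3 > v x0 + m / 3"
      using \<open>m > 0\<close> m_def by argo
    then show ?thesis
      using w by (simp add: ennreal_mult[symmetric] ennreal_lessI)
  qed
  finally show False by simp
qed
end
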